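(* Let $s$ and $s^*$ be an S$_1$-cmc pair in $\mathbb{R}^3$ with sphere centers $c,c^*$ such that the Gauss map $n$, given by $n_v:=c^*_v-c_v$, forms a two-sphere Koebe net. Then the pair $(s,n)$ has constant discrete mean curvature $H=1$. The Christoffel dual is a constant vertex offset surface in normal direction at distance $1$: $c^*=c+n$.
   Context: Combinatorics: $\mathcal G$ is a quad graph (cell decomposition of a surface with quadrilateral faces) with all interior vertices of even valence. Its edges are divided into "horizontal" (label $i$) and "vertical" (label $j$) edges, alternating around each face. The vertices of a face are $v,v_i,v_{ij},v_j$, where $v_i$ and $v_j$ are the horizontal and vertical neighbors of $v$ and $v_{ij}$ is the fourth vertex. Lift of spheres: $\mathbb{R}^{4,1}$ carries $\langle x,y\rangle_{4,1}=x_1y_1+x_2y_2+x_3y_3+x_4y_4-x_5y_5$; $e_0=\frac12(e_5-e_4)$, $e_\infty=\frac12(e_4+e_5)$. An oriented sphere in $\mathbb{R}^3$ with center $c$ and signed radius $d$ is lifted to $\hat s=\frac1d\big(c+e_0+(\|c\|^2-d^2)e_\infty\big)$. S-isothermic: a map $s$ from $V(\mathcal G)$ to oriented spheres in $\mathbb{R}^3$ is S-isothermic if on every face $\hat s_{v_{ij}}-\hat s_v=a_{ij}(\hat s_{v_j}-\hat s_{v_i})$ for some $a_{ij}\in\mathbb{R}$ (depending on the face). Centers and signed radii are denoted $c_v,d_v$. It is S$_1$-isothermic if neighboring vertex spheres touch; the orientation of the spheres is chosen so that $\langle\hat s_v,\hat s_{v'}\rangle_{4,1}=-1$ on horizontal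 and $=+1$ on vertical edges. Christoffel dual of $s$: the S-isothermic surface $s^*$ whose centers are obtained by integrating $c^*_{v'}-c^*_v=\frac{c_{v'}-c_v}{d_vd_{v'}}$ over the edges $(v,v')$ and whose radii are $d^*_v=\frac1{d_v}$. More generally it is considered up to translation and global scaling, so that $d_vd_v^*=\lambda$ with an arbitrary global constant $\lambda\in\mathbb{R}$. Darboux pair: two S-isothermic surfaces $s,s^+$ whose lifts satisfy, for every edge $(v,v')$, $\hat s^+_{v'}-\hat s_v=a_+(\hat s^+_v-\hat s_{v'})$ for some $a_+\in\mathbb{R}$ (depending on the edge); each is then called a Darboux transform of the other. S$_1$-cmc pair: an S$_1$-isothermic surface $s$ together with its Christoffel dual $s^*$, where $s^*$ is (after appropriate scaling and translation) simultaneously a Darboux transform of $s$. Two-sphere Koebe net: a Q-net $k:V(\mathcal G)\to\mathbb{R}^3$ (planar faces) whose edges alternately touch two spheres $S^2_+$ and $S^2_-$, concentric with the unit sphere $S^2$ (centered at the origin), whose radii satisfy $r_+r_-=1$. Discrete mean curvature: the center net $c$ and the Gauss map $n$ are nets with planar faces and parallel corresponding edges. For planar polygons $P,Q$ with parallel edges, $A(P)$ denotes the area, a quadratic form, and $A(P,Q)=\frac12(A(P+Q)-A(P)-A(Q))$ the mixed area. The discrete mean curvature of $(s,n)$ is by definition that of $(c,n)$: on a face $f$, $H_f=-\frac{A(c(f),n(f))}{A(c(f))}$, where $c(f),n(f)$ are the quadrilaterals corresponding to $f$. *)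

theory Defs
  imports "HOL-Analysis.Analysis"
begin

unbundle cross3_syntax

section \<open>Quad graphs\<close>

text \<open>
  A cell decomposition of a surface (possibly with boundary, possibly non-orientable, possibly
  with multiple edges) is encoded by its flags, i.e. the mutually incident triples
  (vertex, edge, face). \<open>inv0\<close>, \<open>inv1\<close>, \<open>inv2\<close> exchange the vertex, the edge, the face of a flag,
  keeping the other two members; \<open>inv2 x = x\<close> means that the edge of \<open>x\<close> lies on the boundary.
  \<open>vert x\<close> is the vertex of the flag \<open>x\<close>, and \<open>horizontal x\<close> says that its edge is horizontal.
\<close>

record ('a, 'v) quad_graph =
  flags :: "'a set"
  inv0 :: "'a \<Rightarrow> 'a"
  inv1 :: "'a \<Rightarrow> 'a"
  inv2 :: "'a \<Rightarrow> 'a"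
  vert :: "'a \<Rightarrow> 'v"
  horizontal :: "'a \<Rightarrow> bool"

definition verts :: "('a, 'v) quad_graph \<Rightarrow> 'v set" where
  "verts G = vert G ` flags G"

definition star :: "('a, 'v) quad_graph \<Rightarrow> 'v \<Rightarrow> 'a set" where
  "star G v = {x \<in> flags G. vert G x = v}"

definition interior_vertex :: "('a, 'v) quad_graph \<Rightarrow> 'v \<Rightarrow> bool" where
  "interior_vertex G v \<longleftrightarrow> v \<in> verts G \<and> (\<forall>x\<in>star G v. inv2 G x \<noteq> x)"

text \<open>The valence counts edge ends; \<open>x\<close> and \<open>inv2 G x\<close> belong to the same end.\<close>

definition valence :: "('a, 'v) quad_graph \<Rightarrow> 'v \<Rightarrow> nat" where
  "valence G v = card ((\<lambda>x. {x, inv2 G x}) ` star G v)"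

text \<open>
  Faces are the orbits of \<open>inv0\<close>, \<open>inv1\<close>. The conditions (4) and (5) make each of them consist of
  exactly eight flags, i.e. make every face a quadrilateral. In (3), \<open>inv2 x \<noteq> inv0 x\<close> excludes
  an edge folded onto itself. By (6), vertices are the orbits of \<open>inv1\<close>, \<open>inv2\<close>; by (7) they are
  locally finite, so that the underlying space is a surface. The last three conditions say that
  the label is a property of edges, that it alternates around each face, and that interior
  vertices have even valence.
\<close>

definition is_quad_graph :: "('a, 'v) quad_graph \<Rightarrow> bool" where
  "is_quad_graph G \<longleftrightarrow>
     \<comment> \<open>(1)\<close> (\<forall>x\<in>flags G. inv0 G x \<in> flags G \<and> inv0 G (inv0 G x) = x \<and> inv0 G x \<noteq> x) \<and>
     \<comment> \<open>(2)\<close> (\<forall>x\<in>flags G. inv1 G x \<in> flags G \<and> inv1 G (inv1 G x) = x \<and> inv1 G x \<noteq> x) \<and>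
     \<comment> \<open>(3)\<close> (\<forall>x\<in>flags G. inv2 G x \<in> flags G \<and> inv2 G (inv2 G x) = x \<and>
               inv2 G (inv0 G x) = inv0 G (inv2 G x) \<and> inv2 G x \<noteq> inv0 G x) \<and>
     \<comment> \<open>(4)\<close> (\<forall>x\<in>flags G. inv0 G (inv1 G (inv0 G (inv1 G x))) = inv1 G (inv0 G (inv1 G (inv0 G x)))) \<and>
     \<comment> \<open>(5)\<close> (\<forall>x\<in>flags G. inv0 G (inv1 G x) \<noteq> inv1 G (inv0 G x)) \<and>
     \<comment> \<open>(6)\<close> (\<forall>x\<in>flags G. \<forall>y\<in>flags G. vert G x = vert G y \<longleftrightarrow>
               (x, y) \<in> ({(z, inv1 G z) | z. z \<in> flags G} \<union> {(z, inv2 G z) | z. z \<in> flags G})\<^sup>*) \<and>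
     \<comment> \<open>(7)\<close> (\<forall>v\<in>verts G. finite (star G v)) \<and>
     (\<forall>x\<in>flags G. (horizontal G (inv0 G x) \<longleftrightarrow> horizontal G x) \<and>
                    (horizontal G (inv2 G x) \<longleftrightarrow> horizontal G x)) \<and>
     (\<forall>x\<in>flags G. horizontal G (inv1 G x) \<longleftrightarrow> \<not> horizontal G x) \<and>
     (\<forall>v. interior_vertex G v \<longrightarrow> even (valence G v))"

text \<open>
  A flag \<open>x\<close> determines the directed edge from \<open>vert G x\<close> to \<open>nbr G x\<close>. A flag with horizontal edge
  determines a face together with one of its vertices \<open>v\<close>; \<open>face G x\<close> is then the list
  \<open>[v, v\<^sub>i, v\<^sub>i\<^sub>j, v\<^sub>j]\<close>. Every corner of every face arises from exactly one flag in \<open>corners G\<close>.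
\<close>

definition nbr :: "('a, 'v) quad_graph \<Rightarrow> 'a \<Rightarrow> 'v" where
  "nbr G x = vert G (inv0 G x)"

definition corners :: "('a, 'v) quad_graph \<Rightarrow> 'a set" where
  "corners G = {x \<in> flags G. horizontal G x}"

definition face :: "('a, 'v) quad_graph \<Rightarrow> 'a \<Rightarrow> 'v list" where
  "face G x = [vert G x, nbr G x, nbr G (inv1 G (inv0 G x)), nbr G (inv1 G x)]"


section \<open>Lift of oriented spheres\<close>

record osphere =
  center :: "real^3"
  radius :: real  \<comment> \<open>signed\<close>

definition mink :: "real^5 \<Rightarrow> real^5 \<Rightarrow> real" where
  "mink x y = x$1 * y$1 + x$2 * y$2 + x$3 * y$3 + x$4 * y$4 - x$5 * y$5"

definition e_zero :: "real^5" where
  "e_zero = (1/2) *\<^sub>R (axis 5 1 - axis 4 1)"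

definition e_inf :: "real^5" where
  "e_inf = (1/2) *\<^sub>R (axis 4 1 + axis 5 1)"

definition embed :: "real^3 \<Rightarrow> real^5" where
  "embed p = p$1 *\<^sub>R axis 1 1 + p$2 *\<^sub>R axis 2 1 + p$3 *\<^sub>R axis 3 1"

definition lift :: "osphere \<Rightarrow> real^5" where
  "lift S = (1 / radius S) *\<^sub>R
     (embed (center S) + e_zero + ((norm (center S))\<^sup>2 - (radius S)\<^sup>2) *\<^sub>R e_inf)"

definition spheres_touch :: "osphere \<Rightarrow> osphere \<Rightarrow> bool" where
  "spheres_touch S T \<longleftrightarrow>
     (\<exists>p. sphere (center S) \<bar>radius S\<bar> \<inter> sphere (center T) \<bar>radius T\<bar> = {p})"


section \<open>S-isothermic surfaces and their transformations\<close>

definition S_isothermic :: "('a, 'v) quad_graph \<Rightarrow> ('v \<Rightarrow> osphere) \<Rightarrow> bool" where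
  "S_isothermic G s \<longleftrightarrow>
     (\<forall>v\<in>verts G. radius (s v) \<noteq> 0) \<and>
     (\<forall>x\<in>corners G. \<forall>v vi vij vj. face G x = [v, vi, vij, vj] \<longrightarrow>
        (\<exists>a. lift (s vij) - lift (s v) = a *\<^sub>R (lift (s vj) - lift (s vi))))"

definition S1_isothermic :: "('a, 'v) quad_graph \<Rightarrow> ('v \<Rightarrow> osphere) \<Rightarrow> bool" where
  "S1_isothermic G s \<longleftrightarrow>
     S_isothermic G s \<and>
     (\<forall>x\<in>flags G. spheres_touch (s (vert G x)) (s (nbr G x)) \<and>
        mink (lift (s (vert G x))) (lift (s (nbr G x))) = (if horizontal G x then -1 else 1))"

definition christoffel_dual_normalized ::
    "('a, 'v) quad_graph \<Rightarrow> ('v \<Rightarrow> osphere) \<Rightarrow> ('v \<Rightarrow> osphere) \<Rightarrow> bool" where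
  "christoffel_dual_normalized G s t \<longleftrightarrow>
     (\<forall>x\<in>flags G. center (t (nbr G x)) - center (t (vert G x)) =
        (1 / (radius (s (vert G x)) * radius (s (nbr G x)))) *\<^sub>R
          (center (s (nbr G x)) - center (s (vert G x)))) \<and>
     (\<forall>v\<in>verts G. radius (t v) = 1 / radius (s v))"

text \<open>
  The dual up to translation and scaling. The factor \<open>\<mu>\<close> scales the centers; the radii get
  multiplied by \<open>\<kappa> = \<plusminus>\<mu>\<close>, the sign being a simultaneous choice of orientation of all the spheres.
  Reversing all orientations replaces the lifts by their negatives and so preserves S-isothermicity.
  The two signs must not be tied together: for a Darboux pair with \<open>d\<^sub>v d\<^sub>v\<^sup>* = \<kappa>\<close>, the equation
  of an edge with \<open>d\<^sub>v d\<^sub>v' \<noteq> \<kappa>\<close> forces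
  \<open>c\<^sup>*\<^sub>v' - c\<^sup>*\<^sub>v = - \<kappa> (c\<^sub>v' - c\<^sub>v) / (d\<^sub>v d\<^sub>v')\<close>, that is, \<open>\<mu> = - \<kappa>\<close>.
\<close>

definition christoffel_dual ::
    "('a, 'v) quad_graph \<Rightarrow> ('v \<Rightarrow> osphere) \<Rightarrow> ('v \<Rightarrow> osphere) \<Rightarrow> bool" where
  "christoffel_dual G s t \<longleftrightarrow>
     (\<exists>t0 b \<mu> \<kappa>. christoffel_dual_normalized G s t0 \<and> \<mu> \<noteq> 0 \<and> \<bar>\<kappa>\<bar> = \<bar>\<mu>\<bar> \<and>
        (\<forall>v\<in>verts G. center (t v) = b + \<mu> *\<^sub>R center (t0 v) \<and> radius (t v) = \<kappa> * radius (t0 v)))"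

definition darboux_pair ::
    "('a, 'v) quad_graph \<Rightarrow> ('v \<Rightarrow> osphere) \<Rightarrow> ('v \<Rightarrow> osphere) \<Rightarrow> bool" where
  "darboux_pair G s t \<longleftrightarrow>
     S_isothermic G s \<and> S_isothermic G t \<and>
     (\<forall>x\<in>flags G. \<exists>a. lift (t (nbr G x)) - lift (s (vert G x)) =
                        a *\<^sub>R (lift (t (vert G x)) - lift (s (nbr G x))))"

definition S1_cmc_pair ::
    "('a, 'v) quad_graph \<Rightarrow> ('v \<Rightarrow> osphere) \<Rightarrow> ('v \<Rightarrow> osphere) \<Rightarrow> bool" where
  "S1_cmc_pair G s t \<longleftrightarrow> S1_isothermic G s \<and> christoffel_dual G s t \<and> darboux_pair G s t"


section \<open>Koebe nets and discrete mean curvature\<close>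

definition Q_net :: "('a, 'v) quad_graph \<Rightarrow> ('v \<Rightarrow> real^3) \<Rightarrow> bool" where
  "Q_net G k \<longleftrightarrow> (\<forall>x\<in>corners G. coplanar (k ` set (face G x)))"

text \<open>The line carrying the edge from \<open>p\<close> to \<open>q\<close> is tangent to the sphere of radius \<open>r\<close> around 0.\<close>

definition edge_touches :: "real^3 \<Rightarrow> real^3 \<Rightarrow> real \<Rightarrow> bool" where
  "edge_touches p q r \<longleftrightarrow> p \<noteq> q \<and> (\<exists>m. affine hull {p, q} \<inter> sphere 0 r = {m})"

text \<open>
  Since the labels alternate around each face, edges touch the two spheres alternately iff all
  horizontal edges touch one of them and all vertical edges touch the other. Either sphere may be
  the bigger one.
\<close>

definition two_sphere_koebe :: "('a, 'v) quad_graph \<Rightarrow> ('v \<Rightarrow> real^3) \<Rightarrow> bool" where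
  "two_sphere_koebe G k \<longleftrightarrow>
     Q_net G k \<and>
     (\<exists>rp rm. rp > 0 \<and> rm > 0 \<and> rp * rm = 1 \<and>
        (\<forall>x\<in>flags G. edge_touches (k (vert G x)) (k (nbr G x)) (if horizontal G x then rp else rm)))"

definition edge_parallel ::
    "('a, 'v) quad_graph \<Rightarrow> ('v \<Rightarrow> real^3) \<Rightarrow> ('v \<Rightarrow> real^3) \<Rightarrow> bool" where
  "edge_parallel G c n \<longleftrightarrow>
     (\<forall>x\<in>flags G. collinear {0, c (nbr G x) - c (vert G x), n (nbr G x) - n (vert G x)})"

text \<open>
  Signed area of a closed polygon in a plane with unit normal \<open>N\<close>. Replacing \<open>N\<close> by \<open>-N\<close> changes
  the sign of all areas, hence does not affect the mean curvature below; where the area of \<open>P\<close> does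
  not vanish, the choice made in \<open>plane_normal P\<close> is irrelevant.
\<close>

definition area :: "real^3 \<Rightarrow> (real^3) list \<Rightarrow> real" where
  "area N P = (1/2) * (\<Sum>k<length P. N \<bullet> (P ! k \<times> P ! (Suc k mod length P)))"

definition mixed_area :: "real^3 \<Rightarrow> (real^3) list \<Rightarrow> (real^3) list \<Rightarrow> real" where
  "mixed_area N P Q = (1/2) * (area N (map2 (+) P Q) - area N P - area N Q)"

definition plane_normal :: "(real^3) list \<Rightarrow> real^3" where
  "plane_normal P = (SOME N. norm N = 1 \<and> (\<forall>p\<in>set P. \<forall>q\<in>set P. N \<bullet> (p - q) = 0))"

definition polygon_area :: "(real^3) list \<Rightarrow> real" where
  "polygon_area P = area (plane_normal P) P"

definition mean_curvature :: "('v \<Rightarrow> osphere) \<Rightarrow> ('v \<Rightarrow> real^3) \<Rightarrow> 'v list \<Rightarrow> real" where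
  "mean_curvature s n f =
     (let P = map (\<lambda>v. center (s v)) f; Q = map n f; N = plane_normal P
      in - mixed_area N P Q / area N P)"

text \<open>
  The pair \<open>(s, n)\<close> has constant discrete mean curvature \<open>H\<close>. The first three conjuncts are what the
  notion presupposes; \<open>H\<^sub>f\<close> is defined only on the faces with nonzero area.
\<close>

definition constant_mean_curvature ::
    "('a, 'v) quad_graph \<Rightarrow> ('v \<Rightarrow> osphere) \<Rightarrow> ('v \<Rightarrow> real^3) \<Rightarrow> real \<Rightarrow> bool" where
  "constant_mean_curvature G s n H \<longleftrightarrow>
     Q_net G (\<lambda>v. center (s v)) \<and> Q_net G n \<and> edge_parallel G (\<lambda>v. center (s v)) n \<and>
     (\<forall>x\<in>corners G. polygon_area (map (\<lambda>v. center (s v)) (face G x)) \<noteq> 0 \<longrightarrow>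
        mean_curvature s n (face G x) = H)"

definition vertex_offset ::
    "('a, 'v) quad_graph \<Rightarrow> ('v \<Rightarrow> real^3) \<Rightarrow> ('v \<Rightarrow> real^3) \<Rightarrow> real \<Rightarrow> ('v \<Rightarrow> real^3) \<Rightarrow> bool" where
  "vertex_offset G c n h c' \<longleftrightarrow> (\<forall>v\<in>verts G. c' v = c v + h *\<^sub>R n v)"

end

theory Submission
  imports Defs
begin

text \<open>
  In a face, the S-isothermic relation \<open>lift s\<^sub>i\<^sub>j - lift s = a (lift s\<^sub>j - lift s\<^sub>i)\<close> splits into the same
  relation for \<open>c/d\<close> and for \<open>1/d\<close>. It makes the face of centers planar, and it makes each diagonal of
  the Christoffel dual face parallel to the opposite diagonal of the original one. The latter says
  that the mixed area \<open>A(c, c\<^sup>*)\<close> vanishes, so that \<open>A(c, n) = A(c, c\<^sup>*) - A(c) = - A(c)\<close>.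
\<close>

section \<open>The face relation in terms of centers and radii\<close>

lemma lift_center: "radius S \<noteq> 0 \<Longrightarrow>
    (1 / radius S) *\<^sub>R center S = vector [lift S $ 1, lift S $ 2, lift S $ 3]"
  by (simp add: vec_eq_iff forall_3 lift_def embed_def e_zero_def e_inf_def axis_def)

text \<open>The functional \<open>y $ 5 - y $ 4\<close> is 1 on \<open>e_zero\<close> and 0 on
  \<open>e_inf\<close> and on embedded centers, so it isolates the coefficient of
  \<open>e_zero\<close>. For radius 0 both sides are 0, since division by 0 yields 0.\<close>

lemma lift_radius: "1 / radius S = lift S $ 5 - lift S $ 4"
  by (simp add: lift_def embed_def e_zero_def e_inf_def axis_def field_simps)

text \<open>Taking the first three coordinates and taking coordinate 5 minus coordinate 4 are linear
  maps, so both carry the relation between lifts over with the same factor \<open>a\<close>.\<close>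

lemma lift_relation:
  assumes "lift S12 - lift S = a *\<^sub>R (lift S2 - lift S1)"
    and "radius S \<noteq> 0" "radius S1 \<noteq> 0" "radius S12 \<noteq> 0" "radius S2 \<noteq> 0"
  shows "(1 / radius S12) *\<^sub>R center S12 - (1 / radius S) *\<^sub>R center S =
      a *\<^sub>R ((1 / radius S2) *\<^sub>R center S2 - (1 / radius S1) *\<^sub>R center S1)"
    and "1 / radius S12 - 1 / radius S = a * (1 / radius S2 - 1 / radius S1)"
proof -
  have comp: "lift S12 $ i - lift S $ i = a * (lift S2 $ i - lift S1 $ i)" for i
    using arg_cong[OF assms(1), of "\<lambda>y. y $ i"] by simp
  show "(1 / radius S12) *\<^sub>R center S12 - (1 / radius S) *\<^sub>R center S =
      a *\<^sub>R ((1 / radius S2) *\<^sub>R center S2 - (1 / radius S1) *\<^sub>R center S1)"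
    unfolding lift_center[OF assms(2)] lift_center[OF assms(3)] lift_center[OF assms(4)]
      lift_center[OF assms(5)]
    by (simp add: vec_eq_iff forall_3 comp)
  show "1 / radius S12 - 1 / radius S = a * (1 / radius S2 - 1 / radius S1)"
    unfolding lift_radius using comp[of 4] comp[of 5] by (simp add: algebra_simps)
qed

text \<open>Solving the first relation for \<open>c12\<close> writes it as a linear combination of
  \<open>c\<close>, \<open>c1\<close>, \<open>c2\<close>. The second relation says exactly that the
  coefficients sum to 1, so the combination is affine.\<close>

lemma coplanar_weighted_relation:
  fixes c c1 c12 c2 :: "real^3"
  assumes "(1/d12) *\<^sub>R c12 - (1/d) *\<^sub>R c = a *\<^sub>R ((1/d2) *\<^sub>R c2 - (1/d1) *\<^sub>R c1)"
    and "1/d12 - 1/d = a * (1/d2 - 1/d1)" "d12 \<noteq> 0"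
  shows "coplanar {c, c1, c12, c2}"
proof -
  define u where "u = d12 / d"
  define v where "v = - d12 * a / d1"
  define w where "w = d12 * a / d2"
  have "u + v + w = d12 * (1/d + a * (1/d2 - 1/d1))"
    by (simp add: u_def v_def w_def algebra_simps)
  also have "\<dots> = 1"
    using assms(3) by (simp add: assms(2)[symmetric])
  finally have uvw: "u + v + w = 1" .
  have "c12 = d12 *\<^sub>R ((1/d12) *\<^sub>R c12)"
    using assms(3) by simp
  also have "(1/d12) *\<^sub>R c12 = (1/d) *\<^sub>R c + a *\<^sub>R ((1/d2) *\<^sub>R c2 - (1/d1) *\<^sub>R c1)"
    using assms(1) by (simp add: algebra_simps)
  also have "d12 *\<^sub>R \<dots> = u *\<^sub>R c + v *\<^sub>R c1 + w *\<^sub>R c2"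
    by (simp add: u_def v_def w_def algebra_simps)
  finally have "c12 \<in> affine hull {c, c1, c2}"
    using uvw unfolding affine_hull_3 by blast
  then have "{c, c1, c12, c2} \<subseteq> affine hull {c, c1, c2}"
    by (simp add: hull_inc)
  then show ?thesis
    unfolding coplanar_def by blast
qed

text \<open>The left sides are built from edge differences of the dual: the path from
  \<open>c\<close> through \<open>c1\<close> to \<open>c12\<close>, and the difference of two edges
  starting at \<open>c\<close>. Collecting terms leaves the two assumptions, weighted by
  \<open>1/d1\<close> and \<open>1/d\<close>. The factor \<open>a\<close> stays on the left of the
  second identity so that nothing is divided by it here.\<close>

lemma dual_diagonals:
  fixes c c1 c12 c2 :: "'b::real_vector"
  assumes "(1/d12) *\<^sub>R c12 - (1/d) *\<^sub>R c = a *\<^sub>R ((1/d2) *\<^sub>R c2 - (1/d1) *\<^sub>R c1)"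
    and "1/d12 - 1/d = a * (1/d2 - 1/d1)"
  shows "(1/(d*d1)) *\<^sub>R (c1 - c) + (1/(d1*d12)) *\<^sub>R (c12 - c1) = (a/(d1*d2)) *\<^sub>R (c2 - c1)"
    and "a *\<^sub>R ((1/(d*d2)) *\<^sub>R (c2 - c) - (1/(d*d1)) *\<^sub>R (c1 - c)) = (1/(d*d12)) *\<^sub>R (c12 - c)"
proof -
  have "(1/(d*d1)) *\<^sub>R (c1 - c) + (1/(d1*d12)) *\<^sub>R (c12 - c1)
      = (1/d1) *\<^sub>R (((1/d12) *\<^sub>R c12 - (1/d) *\<^sub>R c) - (1/d12 - 1/d) *\<^sub>R c1)"
    by (simp add: algebra_simps)
  also have "\<dots> = (a/(d1*d2)) *\<^sub>R (c2 - c1)"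
    unfolding assms by (simp add: algebra_simps)
  finally show "(1/(d*d1)) *\<^sub>R (c1 - c) + (1/(d1*d12)) *\<^sub>R (c12 - c1) = (a/(d1*d2)) *\<^sub>R (c2 - c1)" .
  have "a *\<^sub>R ((1/(d*d2)) *\<^sub>R (c2 - c) - (1/(d*d1)) *\<^sub>R (c1 - c))
      = (1/d) *\<^sub>R (a *\<^sub>R ((1/d2) *\<^sub>R c2 - (1/d1) *\<^sub>R c1) - (a * (1/d2 - 1/d1)) *\<^sub>R c)"
    by (simp add: algebra_simps)
  also have "\<dots> = (1/(d*d12)) *\<^sub>R (c12 - c)"
    unfolding assms[symmetric] by (simp add: algebra_simps)
  finally show "a *\<^sub>R ((1/(d*d2)) *\<^sub>R (c2 - c) - (1/(d*d1)) *\<^sub>R (c1 - c)) = (1/(d*d12)) *\<^sub>R (c12 - c)" .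
qed

section \<open>Area and mixed area of quadrilaterals\<close>

text \<open>The shoelace sum factors through the two diagonals. Hence information about diagonals is
  all that the curvature computation needs.\<close>

lemma area_quadrilateral:
  "area N [p, q, r, t] = (1/2) * (N \<bullet> ((r - p) \<times> (t - q)))"
proof -
  have diagonals: "(r - p) \<times> (t - q) = p \<times> q + q \<times> r + r \<times> t + t \<times> p"
    by (simp add: Cross3.left_diff_distrib Cross3.right_diff_distrib cross_skew[of q r]
        cross_skew[of t p])
  have indices: "{..<length [p, q, r, t]} = {0, 1, 2, 3}"
    by auto
  show ?thesis
    unfolding area_def indices diagonals by (simp add: inner_add_right)
qed

text \<open>Polarization of the diagonal formula: the diagonals of a vertexwise sum are the sums of
  the diagonals.\<close>

lemma mixed_area_quadrilateral:
  "mixed_area N [p, q, r, t] [p', q', r', t'] =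
     (1/4) * (N \<bullet> ((r - p) \<times> (t' - q') + (r' - p') \<times> (t - q)))"
proof -
  have "(r + r' - (p + p')) \<times> (t + t' - (q + q')) = (r - p) \<times> (t - q) + (r' - p') \<times> (t' - q')
      + ((r - p) \<times> (t' - q') + (r' - p') \<times> (t - q))"
    by (simp add: cross3_simps)
  then show ?thesis
    by (simp add: mixed_area_def area_quadrilateral inner_add_right field_simps)
qed

text \<open>The \<alpha> and \<beta> terms contribute cross products of parallel vectors and vanish;
  the subtracted diagonals contribute the area twice with a minus sign. The assumptions have the
  form met by the diagonals of \<open>n\<close>, a dual diagonal minus an original one.\<close>

lemma mixed_area_antiparallel_diagonals:
  assumes "r' - p' = \<alpha> *\<^sub>R (t - q) - (r - p)" "t' - q' = \<beta> *\<^sub>R (r - p) - (t - q)"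
  shows "mixed_area N [p, q, r, t] [p', q', r', t'] = - area N [p, q, r, t]"
proof -
  have "(r - p) \<times> (t' - q') + (r' - p') \<times> (t - q) = (-2) *\<^sub>R ((r - p) \<times> (t - q))"
    unfolding assms
    by (simp add: cross_mult_left cross_mult_right Cross3.left_diff_distrib
        Cross3.right_diff_distrib scaleR_2 cross_skew[of t q])
  then show ?thesis
    by (simp add: mixed_area_quadrilateral area_quadrilateral)
qed

section \<open>Edges and corners of the quad graph\<close>

lemma vert_inv1:
  assumes "is_quad_graph G" "x \<in> flags G"
  shows "inv1 G x \<in> flags G" "vert G (inv1 G x) = vert G x"
proof -
  show flag: "inv1 G x \<in> flags G"
    using assms(1)[unfolded is_quad_graph_def, THEN conjunct2, THEN conjunct1] assms(2) by simp
  have "(x, inv1 G x) \<in>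
      ({(z, inv1 G z) | z. z \<in> flags G} \<union> {(z, inv2 G z) | z. z \<in> flags G})\<^sup>*"
    using assms(2) by (intro r_into_rtrancl) blast
  moreover have "\<forall>x\<in>flags G. \<forall>y\<in>flags G. vert G x = vert G y \<longleftrightarrow>
      (x, y) \<in> ({(z, inv1 G z) | z. z \<in> flags G} \<union> {(z, inv2 G z) | z. z \<in> flags G})\<^sup>*"
    using assms(1) unfolding is_quad_graph_def by (elim conjE) assumption
  ultimately have "vert G x = vert G (inv1 G x)"
    using assms(2) flag by simp
  then show "vert G (inv1 G x) = vert G x" ..
qed

lemma inv0_flag: "is_quad_graph G \<Longrightarrow> x \<in> flags G \<Longrightarrow> inv0 G x \<in> flags G"
  using is_quad_graph_def[THEN iffD1, THEN conjunct1] by blast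

text \<open>The translation \<open>b\<close> cancels along an edge and \<kappa> acts on the radii
  alone, so one global factor \<mu> describes all edge differences of the centers.\<close>

lemma christoffel_dual_edge:
  assumes "is_quad_graph G" "christoffel_dual G s t"
  obtains \<mu> where "\<And>x. x \<in> flags G \<Longrightarrow> center (t (nbr G x)) - center (t (vert G x)) =
    \<mu> *\<^sub>R (1 / (radius (s (vert G x)) * radius (s (nbr G x)))) *\<^sub>R
      (center (s (nbr G x)) - center (s (vert G x)))"
proof -
  obtain t0 b \<mu> where t0: "christoffel_dual_normalized G s t0"
    and t: "\<And>v. v \<in> verts G \<Longrightarrow> center (t v) = b + \<mu> *\<^sub>R center (t0 v)"
    using assms(2) unfolding christoffel_dual_def by blast
  show ?thesis
  proof
    fix x assume x: "x \<in> flags G"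
    then have "vert G x \<in> verts G" "nbr G x \<in> verts G"
      using inv0_flag[OF assms(1)] by (auto simp: verts_def nbr_def)
    then have "center (t (nbr G x)) - center (t (vert G x)) =
        \<mu> *\<^sub>R (center (t0 (nbr G x)) - center (t0 (vert G x)))"
      by (simp add: t scaleR_diff_right)
    then show "center (t (nbr G x)) - center (t (vert G x)) =
        \<mu> *\<^sub>R (1 / (radius (s (vert G x)) * radius (s (nbr G x)))) *\<^sub>R
          (center (s (nbr G x)) - center (s (vert G x)))"
      using t0 x unfolding christoffel_dual_normalized_def by simp
  qed
qed

lemma corner_relation:
  assumes G: "is_quad_graph G" and s: "S_isothermic G s" and x: "x \<in> corners G"
    and f: "face G x = [v, vi, vij, vj]"
  obtains a where
    "(1 / radius (s vij)) *\<^sub>R center (s vij) - (1 / radius (s v)) *\<^sub>R center (s v) =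
      a *\<^sub>R ((1 / radius (s vj)) *\<^sub>R center (s vj) - (1 / radius (s vi)) *\<^sub>R center (s vi))"
    "1 / radius (s vij) - 1 / radius (s v) = a * (1 / radius (s vj) - 1 / radius (s vi))"
    "set (face G x) \<subseteq> verts G"
    "radius (s v) \<noteq> 0" "radius (s vi) \<noteq> 0" "radius (s vij) \<noteq> 0" "radius (s vj) \<noteq> 0"
proof -
  have "x \<in> flags G"
    using x by (simp add: corners_def)
  then have sub: "set (face G x) \<subseteq> verts G"
    by (simp add: face_def nbr_def verts_def inv0_flag[OF G] vert_inv1(1)[OF G])
  obtain a where "lift (s vij) - lift (s v) = a *\<^sub>R (lift (s vj) - lift (s vi))"
    using s x f unfolding S_isothermic_def by blast
  moreover have r: "radius (s v) \<noteq> 0" "radius (s vi) \<noteq> 0" "radius (s vij) \<noteq> 0" "radius (s vj) \<noteq> 0"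
    using s sub f unfolding S_isothermic_def by auto
  ultimately show ?thesis
    using that[OF lift_relation[OF _ r] sub r] by blast
qed

section \<open>Planarity, mean curvature and parallel edges\<close>

lemma Q_net_centers:
  assumes "is_quad_graph G" "S_isothermic G s"
  shows "Q_net G (\<lambda>v. center (s v))"
  unfolding Q_net_def
proof
  fix x assume x: "x \<in> corners G"
  obtain v vi vij vj where f: "face G x = [v, vi, vij, vj]"
    unfolding face_def by blast
  show "coplanar ((\<lambda>v. center (s v)) ` set (face G x))"
  proof (rule corner_relation[OF assms x f])
    fix a
    assume "(1 / radius (s vij)) *\<^sub>R center (s vij) - (1 / radius (s v)) *\<^sub>R center (s v) =
        a *\<^sub>R ((1 / radius (s vj)) *\<^sub>R center (s vj) - (1 / radius (s vi)) *\<^sub>R center (s vi))"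
      and "1 / radius (s vij) - 1 / radius (s v) = a * (1 / radius (s vj) - 1 / radius (s vi))"
      and "radius (s vij) \<noteq> 0"
    then have "coplanar {center (s v), center (s vi), center (s vij), center (s vj)}"
      by (rule coplanar_weighted_relation)
    then show ?thesis
      by (simp add: f)
  qed
qed

lemma mean_curvature_christoffel_dual:
  assumes G: "is_quad_graph G" and s: "S_isothermic G s" and dual: "christoffel_dual G s t"
    and n: "\<And>v. v \<in> verts G \<Longrightarrow> n v = center (t v) - center (s v)"
    and x: "x \<in> corners G" and area: "polygon_area (map (\<lambda>v. center (s v)) (face G x)) \<noteq> 0"
  shows "mean_curvature s n (face G x) = 1"
proof -
  define v vi vij vj where "v = vert G x" and "vi = nbr G x"
    and "vij = nbr G (inv1 G (inv0 G x))" and "vj = nbr G (inv1 G x)"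
  have f: "face G x = [v, vi, vij, vj]"
    by (simp add: face_def v_def vi_def vij_def vj_def)
  obtain \<mu> where edge: "\<And>x. x \<in> flags G \<Longrightarrow> center (t (nbr G x)) - center (t (vert G x)) =
    \<mu> *\<^sub>R (1 / (radius (s (vert G x)) * radius (s (nbr G x)))) *\<^sub>R
      (center (s (nbr G x)) - center (s (vert G x)))"
    using christoffel_dual_edge[OF G dual] by blast
  obtain a where rel:
    "(1 / radius (s vij)) *\<^sub>R center (s vij) - (1 / radius (s v)) *\<^sub>R center (s v) =
      a *\<^sub>R ((1 / radius (s vj)) *\<^sub>R center (s vj) - (1 / radius (s vi)) *\<^sub>R center (s vi))"
    "1 / radius (s vij) - 1 / radius (s v) = a * (1 / radius (s vj) - 1 / radius (s vi))"
    and sub: "set (face G x) \<subseteq> verts G" and r: "radius (s v) \<noteq> 0" "radius (s vij) \<noteq> 0"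
    by (rule corner_relation[OF G s x f])
  define N where "N = plane_normal (map (\<lambda>v. center (s v)) (face G x))"
  define c where "c = (\<lambda>v. center (s v))"
  define c' where "c' = (\<lambda>v. center (t v))"
  define d where "d = (\<lambda>v. radius (s v))"
  have A: "area N [c v, c vi, c vij, c vj] \<noteq> 0"
    using area by (simp add: polygon_area_def N_def f c_def)
  \<comment> \<open>For \<open>a = 0\<close> the radii and then the centers at \<open>v\<close> and
    \<open>vij\<close> agree; a diagonal would vanish, and the area with it.\<close>
  have a: "a \<noteq> 0"
  proof
    assume "a = 0"
    then have "c vij = c v"
      using rel r by (simp add: c_def d_def)
    then show False
      using A by (simp add: area_quadrilateral)
  qed
  \<comment> \<open>These flags represent the directed edges \<open>v\<close> to \<open>vi\<close>,
    \<open>v\<close> to \<open>vj\<close> and \<open>vi\<close> to \<open>vij\<close>, whose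
    differences determine both diagonals.\<close>
  have x': "x \<in> flags G" "inv1 G x \<in> flags G" "inv1 G (inv0 G x) \<in> flags G"
    "vert G (inv1 G x) = v" "vert G (inv1 G (inv0 G x)) = vi"
    using x vert_inv1[OF G] inv0_flag[OF G] by (auto simp: corners_def v_def vi_def nbr_def)
  have e1: "c' vi - c' v = \<mu> *\<^sub>R (1 / (d v * d vi)) *\<^sub>R (c vi - c v)"
    and e2: "c' vj - c' v = \<mu> *\<^sub>R (1 / (d v * d vj)) *\<^sub>R (c vj - c v)"
    and e12: "c' vij - c' vi = \<mu> *\<^sub>R (1 / (d vi * d vij)) *\<^sub>R (c vij - c vi)"
    unfolding c_def c'_def d_def
    using edge[OF x'(1), folded v_def vi_def]
      edge[OF x'(2), unfolded x'(4), folded vj_def]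
      edge[OF x'(3), unfolded x'(5), folded vij_def] by blast+
  have "(1 / d vij) *\<^sub>R c vij - (1 / d v) *\<^sub>R c v =
      a *\<^sub>R ((1 / d vj) *\<^sub>R c vj - (1 / d vi) *\<^sub>R c vi)"
    and "1 / d vij - 1 / d v = a * (1 / d vj - 1 / d vi)"
    unfolding c_def d_def by (rule rel)+
  note diag = dual_diagonals[OF this]
  have "c' vij - c' v = (c' vi - c' v) + (c' vij - c' vi)"
    by simp
  also have "\<dots> = \<mu> *\<^sub>R ((1 / (d v * d vi)) *\<^sub>R (c vi - c v) + (1 / (d vi * d vij)) *\<^sub>R (c vij - c vi))"
    unfolding e1 e12 by (rule scaleR_add_right[symmetric])
  also have "\<dots> = (\<mu> * (a / (d vi * d vj))) *\<^sub>R (c vj - c vi)"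
    unfolding diag(1) by simp
  finally have D1: "c' vij - c' v = (\<mu> * (a / (d vi * d vj))) *\<^sub>R (c vj - c vi)" .
  \<comment> \<open>Both edges start at \<open>v\<close>, as in the second identity of
    \<open>dual_diagonals\<close>; since \<open>a\<close> is nonzero, that identity can be solved
    for this diagonal.\<close>
  have "c' vj - c' vi = (c' vj - c' v) - (c' vi - c' v)"
    by simp
  also have "\<dots> = (\<mu> / a) *\<^sub>R
      (a *\<^sub>R ((1 / (d v * d vj)) *\<^sub>R (c vj - c v) - (1 / (d v * d vi)) *\<^sub>R (c vi - c v)))"
    unfolding e1 e2 using a by (simp add: scaleR_diff_right)
  also have "\<dots> = (\<mu> / a * (1 / (d v * d vij))) *\<^sub>R (c vij - c v)"
    unfolding diag(2) by simp
  finally have D2: "c' vj - c' vi = (\<mu> / a * (1 / (d v * d vij))) *\<^sub>R (c vij - c v)" .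
  have nc: "n w = c' w - c w" if "w \<in> {v, vi, vij, vj}" for w
    using n[of w] sub that f by (auto simp: c_def c'_def)
  have "mixed_area N [c v, c vi, c vij, c vj] [n v, n vi, n vij, n vj] = - area N [c v, c vi, c vij, c vj]"
  proof (rule mixed_area_antiparallel_diagonals)
    show "n vij - n v = (\<mu> * (a / (d vi * d vj))) *\<^sub>R (c vj - c vi) - (c vij - c v)"
      unfolding D1[symmetric] by (simp add: nc)
    show "n vj - n vi = (\<mu> / a * (1 / (d v * d vij))) *\<^sub>R (c vij - c v) - (c vj - c vi)"
      unfolding D2[symmetric] by (simp add: nc)
  qed
  then show ?thesis
    using A by (simp add: mean_curvature_def Let_def f N_def c_def)
qed

text \<open>If an edge of the dual is \<open>k\<close> times the original one, the corresponding
  edge of \<open>n\<close> is \<open>k - 1\<close> times it.\<close>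

lemma edge_parallel_christoffel_dual:
  assumes G: "is_quad_graph G" and dual: "christoffel_dual G s t"
    and n: "\<And>v. v \<in> verts G \<Longrightarrow> n v = center (t v) - center (s v)"
  shows "edge_parallel G (\<lambda>v. center (s v)) n"
  unfolding edge_parallel_def
proof
  fix x assume x: "x \<in> flags G"
  obtain \<mu> where "\<And>x. x \<in> flags G \<Longrightarrow> center (t (nbr G x)) - center (t (vert G x)) =
    \<mu> *\<^sub>R (1 / (radius (s (vert G x)) * radius (s (nbr G x)))) *\<^sub>R
      (center (s (nbr G x)) - center (s (vert G x)))"
    using christoffel_dual_edge[OF G dual] by blast
  from this[OF x] obtain k where k: "center (t (nbr G x)) - center (t (vert G x)) =
      k *\<^sub>R (center (s (nbr G x)) - center (s (vert G x)))"
    by (metis scaleR_scaleR)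
  have "vert G x \<in> verts G" "nbr G x \<in> verts G"
    using x inv0_flag[OF G] by (auto simp: verts_def nbr_def)
  then have "n (nbr G x) - n (vert G x) = (center (t (nbr G x)) - center (t (vert G x)))
      - (center (s (nbr G x)) - center (s (vert G x)))"
    by (simp add: n)
  also have "\<dots> = (k - 1) *\<^sub>R (center (s (nbr G x)) - center (s (vert G x)))"
    unfolding k by (simp add: scaleR_diff_left)
  finally show "collinear {0, center (s (nbr G x)) - center (s (vert G x)), n (nbr G x) - n (vert G x)}"
    unfolding collinear_lemma by blast
qed

theorem theorem3p9:
  fixes G :: "('a, 'v) quad_graph"
    and s s' :: "'v \<Rightarrow> osphere"
    and n :: "'v \<Rightarrow> real^3"
  assumes "is_quad_graph G"
    and "S1_cmc_pair G s s'"
    and "\<And>v. v \<in> verts G \<Longrightarrow> n v = center (s' v) - center (s v)"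
    and "two_sphere_koebe G n"
  shows "constant_mean_curvature G s n 1 \<and>
         vertex_offset G (\<lambda>v. center (s v)) n 1 (\<lambda>v. center (s' v))"
proof
  have s: "S_isothermic G s" and dual: "christoffel_dual G s s'"
    using assms(2) by (auto simp: S1_cmc_pair_def S1_isothermic_def)
  \<comment> \<open>Planarity of the faces of the Gauss map comes from the Koebe property.\<close>
  have "Q_net G n"
    using assms(4) by (simp add: two_sphere_koebe_def)
  then show "constant_mean_curvature G s n 1"
    unfolding constant_mean_curvature_def
    using Q_net_centers[OF assms(1) s] edge_parallel_christoffel_dual[OF assms(1) dual assms(3)]
      mean_curvature_christoffel_dual[OF assms(1) s dual assms(3)] by blast
  \<comment> \<open>At distance 1 the offset equation is the defining equation of \<open>n\<close>,
    rearranged.\<close>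
  show "vertex_offset G (\<lambda>v. center (s v)) n 1 (\<lambda>v. center (s' v))"
    by (simp add: vertex_offset_def assms(3))
qed

end
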